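(* Let $\mathcal{S}\in\mathbb{C}^{p\times q\times n}$ and let $\mathcal{T}\in\mathbb{C}^{p\times p\times n}$ with $\mathrm{ind}_t(\mathcal{T})=k$. Then: (i) $\mathcal{S}^{\dagger}=\mathcal{S}^{(2)}_{\mathscr{R}(\mathcal{S}^* ),\mathscr{N}(\mathcal{S}^* )}$. (ii) $\mathcal{T}^{D}=\mathcal{T}^{(2)}_{\mathscr{R}(\mathcal{T}^k),\mathscr{N}(\mathcal{T}^k)}$.
   Context: A third-order tensor $\mathcal{A}\in\mathbb{C}^{a\times b\times n}$ has frontal slices $A_1,\dots,A_n\in\mathbb{C}^{a\times b}$, $A_k=\mathcal{A}(:,:,k)$. $\mathrm{bcirc}(\mathcal{A})\in\mathbb{C}^{an\times bn}$ is the block circulant matrix whose $(i,j)$ block ($1\le i,j\le n$) is $A_{((i-j)\bmod n)+1}$. For $\mathcal{A}\in\mathbb{C}^{a\times b\times n}$ and $\mathcal{B}\in\mathbb{C}^{b\times c\times n}$, the $t$-product $\mathcal{A}*\mathcal{B}\in\mathbb{C}^{a\times c\times n}$ is the unique tensor with $\mathrm{bcirc}(\mathcal{A}*\mathcal{B})=\mathrm{bcirc}(\mathcal{A})\,\mathrm{bcirc}(\mathcal{B})$; powers are taken with respect to $*$, with $\mathcal{A}^0$ the identity tensor (the tensor whose $\mathrm{bcirc}$ is the identity matrix). $\mathcal{A}^*$ is the conjugate transpose, i.e. the tensor with $\mathrm{bcirc}(\mathcal{A}^* )=\mathrm{bcirc}(\mathcal{A})^*$. The $t$-range space $\mathscr{R}(\mathcal{A})$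 is the range (column space) of $\mathrm{bcirc}(\mathcal{A})$ and the $t$-null space $\mathscr{N}(\mathcal{A})$ is the null space of $\mathrm{bcirc}(\mathcal{A})$. The $t$-index $\mathrm{ind}_t(\mathcal{T})$ of $\mathcal{T}\in\mathbb{C}^{p\times p\times n}$ is the smallest nonnegative integer $k$ with $\mathrm{rank}(\mathrm{bcirc}(\mathcal{T})^k)=\mathrm{rank}(\mathrm{bcirc}(\mathcal{T})^{k+1})$. The Moore-Penrose inverse $\mathcal{S}^\dagger\in\mathbb{C}^{q\times p\times n}$ is the unique $\mathcal{X}$ with $\mathcal{S}*\mathcal{X}*\mathcal{S}=\mathcal{S}$, $\mathcal{X}*\mathcal{S}*\mathcal{X}=\mathcal{X}$, $(\mathcal{S}*\mathcal{X})^*=\mathcal{S}*\mathcal{X}$, $(\mathcal{X}*\mathcal{S})^*=\mathcal{X}*\mathcal{S}$. With $k=\mathrm{ind}_t(\mathcal{T})$, the Drazin inverse $\mathcal{T}^D\in\mathbb{C}^{p\times p\times n}$ is the unique $\mathcal{X}$ with $\mathcal{T}^{k+1}*\mathcal{X}=\mathcal{T}^k$, $\mathcal{X}*\mathcal{T}*\mathcal{X}=\mathcal{X}$, $\mathcal{T}*\mathcal{X}=\mathcal{X}*\mathcal{T}$. For $\mathcal{A}\in\mathbb{C}^{a\times b\times n}$, $\mathcal{A}^{(2)}_{\mathscr{R}(\mathcal{B}),\mathscr{N}(\mathcal{C})}$ denotes the tensor $\mathcal{X}\in\mathbb{C}^{b\times a\times n}$ (unique if it exists) with $\mathcal{X}*\mathcal{A}*\mathcal{X}=\mathcal{X}$,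 $\mathscr{R}(\mathcal{X})=\mathscr{R}(\mathcal{B})$, $\mathscr{N}(\mathcal{X})=\mathscr{N}(\mathcal{C})$. *)

theory Defs
  imports
    "Jordan_Normal_Form.DL_Rank"
    "Jordan_Normal_Form.Matrix_Kernel"
    "Jordan_Normal_Form.Schur_Decomposition"
begin

section \<open>Third-order tensors and block circulant matrices\<close>

text \<open>A tensor in \<open>\<complex>\<^bsup>a\<times>b\<times>n\<^esup>\<close> is the list of its \<open>n\<close> frontal slices. Indices start at 0, so
  \<open>A ! k\<close> is the slice \<open>A\<^bsub>k+1\<^esub>\<close> of the usual notation. The dimensions \<open>a\<close> and \<open>b\<close> are read off
  the first slice, hence the hypothesis \<open>0 < n\<close> below.\<close>

type_synonym tensor = "complex mat list"

definition tensors :: "nat \<Rightarrow> nat \<Rightarrow> nat \<Rightarrow> tensor set" where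
  "tensors a b n = {A. length A = n \<and> set A \<subseteq> carrier_mat a b}"

definition t_rows :: "tensor \<Rightarrow> nat" where
  "t_rows A = dim_row (A ! 0)"

definition t_cols :: "tensor \<Rightarrow> nat" where
  "t_cols A = dim_col (A ! 0)"

text \<open>Block \<open>(i, j)\<close>, \<open>0 \<le> i, j < n\<close>, is the slice with index \<open>(i - j) mod n\<close>; adding \<open>n\<close> first
  keeps the subtraction on natural numbers from being truncated.\<close>

definition bcirc :: "tensor \<Rightarrow> complex mat" where
  "bcirc A = (let n = length A; a = t_rows A; b = t_cols A in
     mat (a * n) (b * n)
       (\<lambda>(r, s). (A ! ((r div a + n - s div b) mod n)) $$ (r mod a, s mod b)))"

definition tensor_of_bcirc :: "nat \<Rightarrow> nat \<Rightarrow> nat \<Rightarrow> complex mat \<Rightarrow> tensor" where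
  "tensor_of_bcirc a b n M = (THE A. A \<in> tensors a b n \<and> bcirc A = M)"

definition t_prod :: "tensor \<Rightarrow> tensor \<Rightarrow> tensor" (infixl \<open>\<star>\<close> 70) where
  "A \<star> B = tensor_of_bcirc (t_rows A) (t_cols B) (length A) (bcirc A * bcirc B)"

definition t_one :: "nat \<Rightarrow> nat \<Rightarrow> tensor" where
  "t_one p n = tensor_of_bcirc p p n (1\<^sub>m (p * n))"

primrec t_pow :: "tensor \<Rightarrow> nat \<Rightarrow> tensor" where
  "t_pow A 0 = t_one (t_rows A) (length A)"
| "t_pow A (Suc k) = t_pow A k \<star> A"

definition t_adjoint :: "tensor \<Rightarrow> tensor" where
  "t_adjoint A = tensor_of_bcirc (t_cols A) (t_rows A) (length A) (mat_adjoint (bcirc A))"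

definition t_range :: "tensor \<Rightarrow> complex vec set" where
  "t_range A = vec_space.col_space (dim_row (bcirc A)) (bcirc A)"

definition t_null :: "tensor \<Rightarrow> complex vec set" where
  "t_null A = mat_kernel (bcirc A)"

definition t_index :: "tensor \<Rightarrow> nat" where
  "t_index T = (LEAST k. vec_space.rank (dim_row (bcirc T)) (bcirc T ^\<^sub>m k) =
                         vec_space.rank (dim_row (bcirc T)) (bcirc T ^\<^sub>m (k + 1)))"

section \<open>Generalized inverses\<close>

definition is_mp_inverse :: "tensor \<Rightarrow> tensor \<Rightarrow> bool" where
  "is_mp_inverse S X \<longleftrightarrow> X \<in> tensors (t_cols S) (t_rows S) (length S) \<and>
     S \<star> X \<star> S = S \<and> X \<star> S \<star> X = X \<and>
     t_adjoint (S \<star> X) = S \<star> X \<and> t_adjoint (X \<star> S) = X \<star> S"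

definition mp_inverse :: "tensor \<Rightarrow> tensor" where
  "mp_inverse S = (THE X. is_mp_inverse S X)"

definition is_drazin_inverse :: "tensor \<Rightarrow> tensor \<Rightarrow> bool" where
  "is_drazin_inverse T X \<longleftrightarrow> X \<in> tensors (t_rows T) (t_rows T) (length T) \<and>
     t_pow T (t_index T + 1) \<star> X = t_pow T (t_index T) \<and>
     X \<star> T \<star> X = X \<and> T \<star> X = X \<star> T"

definition drazin_inverse :: "tensor \<Rightarrow> tensor" where
  "drazin_inverse T = (THE X. is_drazin_inverse T X)"

definition is_outer_inverse ::
  "tensor \<Rightarrow> complex vec set \<Rightarrow> complex vec set \<Rightarrow> tensor \<Rightarrow> bool" where
  "is_outer_inverse A R N X \<longleftrightarrow> X \<in> tensors (t_cols A) (t_rows A) (length A) \<and>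
     X \<star> A \<star> X = X \<and> t_range X = R \<and> t_null X = N"

definition outer_inverse :: "tensor \<Rightarrow> complex vec set \<Rightarrow> complex vec set \<Rightarrow> tensor" where
  "outer_inverse A R N = (THE X. is_outer_inverse A R N X)"

section \<open>The tensor operations are well defined\<close>

lemma tensorsD:
  assumes "A \<in> tensors a b n" "0 < n"
  shows "length A = n" "t_rows A = a" "t_cols A = b" "\<And>k. k < n \<Longrightarrow> A ! k \<in> carrier_mat a b"
  using assms by (force simp: tensors_def t_rows_def t_cols_def subset_iff)+

lemma bcirc_carrier:
  assumes "A \<in> tensors a b n" "0 < n"
  shows "bcirc A \<in> carrier_mat (a * n) (b * n)"
  using tensorsD[OF assms] by (simp add: bcirc_def Let_def)

lemma bcirc_index:
  assumes "A \<in> tensors a b n" "0 < n" "r < a * n" "s < b * n"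
  shows "bcirc A $$ (r, s) = (A ! ((r div a + n - s div b) mod n)) $$ (r mod a, s mod b)"
  using tensorsD[OF assms(1,2)] assms(3,4) by (simp add: bcirc_def Let_def)

lemma bcirc_inj:
  assumes A: "A \<in> tensors a b n" and B: "B \<in> tensors a b n" and n: "0 < n"
    and eq: "bcirc A = bcirc B"
  shows "A = B"
proof (rule nth_equalityI)
  show "length A = length B" using tensorsD[OF A n] tensorsD[OF B n] by simp
next
  fix k assume "k < length A"
  hence k: "k < n" using tensorsD[OF A n] by simp
  show "A ! k = B ! k"
  proof (rule eq_matI)
    fix i j assume "i < dim_row (B ! k)" "j < dim_col (B ! k)"
    hence i: "i < a" and j: "j < b" using tensorsD(4)[OF B n k] by auto
    have "i + k * a < a + k * a" using i by simp
    also have "\<dots> = Suc k * a" by simp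
    also have "\<dots> \<le> n * a" using k by (intro mult_right_mono) auto
    finally have r: "i + k * a < a * n" by (simp add: mult.commute)
    have s: "j < b * n" using j n by (metis less_le_trans mult.commute mult_le_mono1 nat_mult_1 Suc_leI One_nat_def)
    have "bcirc A $$ (i + k * a, j) = bcirc B $$ (i + k * a, j)" using eq by simp
    thus "A ! k $$ (i, j) = B ! k $$ (i, j)"
      using i j k unfolding bcirc_index[OF A n r s] bcirc_index[OF B n r s] by simp
  qed (use tensorsD(4)[OF A n k] tensorsD(4)[OF B n k] in auto)
qed

lemma tensor_of_bcirc:
  assumes "A \<in> tensors a b n" "0 < n" "bcirc A = M"
  shows "tensor_of_bcirc a b n M = A"
  unfolding tensor_of_bcirc_def by (rule the_equality) (use assms bcirc_inj in blast)+

lemma tensors_map: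
  assumes "\<And>k. k < n \<Longrightarrow> f k \<in> carrier_mat a b"
  shows "map f [0..<n] \<in> tensors a b n"
  using assms by (auto simp: tensors_def)

lemma cyclic_diff:
  fixes i j n :: nat
  assumes "i < n" "j < n"
  shows "(i + n - j) mod n = (if j \<le> i then i - j else i + n - j)"
proof (cases "j \<le> i")
  case True
  have "(i + n - j) mod n = (i - j + n) mod n" using True by (metis diff_add_assoc2)
  also have "\<dots> = i - j" using assms by simp
  finally show ?thesis using True by simp
qed (use assms in auto)

lemma cyclic_neg:
  fixes i j n :: nat
  assumes "i < n" "j < n"
  shows "(n - (i + n - j) mod n) mod n = (j + n - i) mod n"
  unfolding cyclic_diff[OF assms] cyclic_diff[OF assms(2,1)] using assms
  by (auto intro: mod_less)

lemma bcirc_t_one: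
  assumes n: "0 < n"
  shows "t_one p n \<in> tensors p p n" "bcirc (t_one p n) = 1\<^sub>m (p * n)"
proof -
  define E where "E = map (\<lambda>k. if k = 0 then 1\<^sub>m p else 0\<^sub>m p p :: complex mat) [0..<n]"
  have E: "E \<in> tensors p p n" unfolding E_def by (rule tensors_map) auto
  have "bcirc E = 1\<^sub>m (p * n)"
  proof (rule eq_matI)
    fix r s assume "r < dim_row (1\<^sub>m (p * n) :: complex mat)" "s < dim_col (1\<^sub>m (p * n) :: complex mat)"
    hence r: "r < p * n" and s: "s < p * n" by auto
    hence p: "0 < p" by (cases p) auto
    let ?i = "r div p" and ?j = "s div p"
    have i: "?i < n" and j: "?j < n"
      using r s p by (simp_all add: div_less_iff_less_mult mult.commute)
    have k: "(?i + n - ?j) mod n = 0 \<longleftrightarrow> ?i = ?j"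
      unfolding cyclic_diff[OF i j] using i j by (auto split: if_splits)
    have rs: "r = s \<longleftrightarrow> ?i = ?j \<and> r mod p = s mod p" by (metis div_mult_mod_eq)
    have kn: "(?i + n - ?j) mod n < n" using n by simp
    show "bcirc E $$ (r, s) = 1\<^sub>m (p * n) $$ (r, s)"
      unfolding bcirc_index[OF E n r s] using kn p r s by (auto simp: E_def k rs)
  qed (use bcirc_carrier[OF E n] in auto)
  from tensor_of_bcirc[OF E n this] E this
  show "t_one p n \<in> tensors p p n" "bcirc (t_one p n) = 1\<^sub>m (p * n)"
    by (simp_all add: t_one_def)
qed

lemma bcirc_t_adjoint:
  assumes A: "A \<in> tensors a b n" and n: "0 < n"
  shows "t_adjoint A \<in> tensors b a n" "bcirc (t_adjoint A) = mat_adjoint (bcirc A)"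
proof -
  have adj: "mat_adjoint M $$ (i, j) = cnj (M $$ (j, i))"
    if "i < dim_col M" "j < dim_row M" for M :: "complex mat" and i j
    using that unfolding mat_adjoint_def by (simp add: mat_of_rows_index)
  have adjc: "mat_adjoint M \<in> carrier_mat (dim_col M) (dim_row M)" for M :: "complex mat"
    by (rule carrier_matI) (simp_all add: mat_adjoint_def)
  define E where "E = map (\<lambda>k. mat_adjoint (A ! ((n - k) mod n))) [0..<n]"
  have E: "E \<in> tensors b a n" unfolding E_def
  proof (rule tensors_map)
    fix k
    show "mat_adjoint (A ! ((n - k) mod n)) \<in> carrier_mat b a"
      using tensorsD(4)[OF A n, of "(n - k) mod n"] adjc[of "A ! ((n - k) mod n)"] n by auto
  qed
  note cA = bcirc_carrier[OF A n]
  have "bcirc E = mat_adjoint (bcirc A)"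
  proof (rule eq_matI)
    fix r s assume "r < dim_row (mat_adjoint (bcirc A))" "s < dim_col (mat_adjoint (bcirc A))"
    hence r: "r < b * n" and s: "s < a * n" using adjc[of "bcirc A"] cA by auto
    hence b: "0 < b" and a: "0 < a" by (cases b; simp)(use s in \<open>cases a; simp\<close>)
    let ?i = "r div b" and ?j = "s div a"
    have i: "?i < n" and j: "?j < n"
      using r s a b by (simp_all add: div_less_iff_less_mult mult.commute)
    have k: "(n - (?i + n - ?j) mod n) mod n = (?j + n - ?i) mod n"
      using cyclic_neg[OF i j] .
    have kn: "(?i + n - ?j) mod n < n" "(?j + n - ?i) mod n < n" using n by simp_all
    show "bcirc E $$ (r, s) = mat_adjoint (bcirc A) $$ (r, s)"
      using kn a b r s cA tensorsD(4)[OF A n kn(2)] bcirc_index[OF A n s r]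
      unfolding bcirc_index[OF E n r s] by (simp add: E_def k adj)
  qed (use bcirc_carrier[OF E n] adjc[of "bcirc A"] cA in auto)
  from tensor_of_bcirc[OF E n this] E this
  show "t_adjoint A \<in> tensors b a n" "bcirc (t_adjoint A) = mat_adjoint (bcirc A)"
    by (simp_all add: t_adjoint_def tensorsD[OF A n])
qed

lemma sum_cyclic_shift:
  fixes f :: "nat \<Rightarrow> 'a::comm_monoid_add"
  assumes j: "j < n"
  shows "(\<Sum>l<n. f l) = (\<Sum>l<n. f ((l + j) mod n))"
proof (rule sum.reindex_bij_witness[of _ "\<lambda>l. (l + j) mod n" "\<lambda>l. (l + (n - j)) mod n"])
  fix l assume "l \<in> {..<n}"
  hence l: "l < n" by simp
  have *: "((l + x) mod n + y) mod n = l" if "x + y = n" for x y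
    using l that by (simp add: mod_add_left_eq add.assoc)
  show "((l + (n - j)) mod n + j) mod n = l" "((l + j) mod n + (n - j)) mod n = l"
    by (rule *; use j in simp)+
  show "f (((l + (n - j)) mod n + j) mod n) = f l"
    using \<open>((l + (n - j)) mod n + j) mod n = l\<close> by simp
qed (use j in auto)

lemma sum_blocks:
  fixes f :: "nat \<Rightarrow> 'a::comm_monoid_add"
  shows "(\<Sum>s<b * n. f s) = (\<Sum>l<n. \<Sum>v<b. f (v + l * b))"
proof -
  have shift: "sum f {m..<m + c} = (\<Sum>v<c. f (v + m))" for m c
    by (induction c) (simp_all add: add.commute)
  have "(\<Sum>s<b * n. f s) = (\<Sum>l<n. sum f {l * b..<l * b + b})"
    by (simp add: sum.nat_group mult.commute)
  also have "\<dots> = (\<Sum>l<n. \<Sum>v<b. f (v + l * b))"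
    by (simp add: shift)
  finally show ?thesis .
qed

lemma bcirc_t_prod:
  assumes A: "A \<in> tensors a b n" and B: "B \<in> tensors b c n" and n: "0 < n"
  shows "A \<star> B \<in> tensors a c n" "bcirc (A \<star> B) = bcirc A * bcirc B"
proof -
  define E where "E = map (\<lambda>k. mat a c (\<lambda>(x, y).
    \<Sum>l<n. \<Sum>v<b. A ! ((k + n - l) mod n) $$ (x, v) * B ! l $$ (v, y))) [0..<n]"
  have E: "E \<in> tensors a c n" unfolding E_def by (rule tensors_map) auto
  note cA = bcirc_carrier[OF A n] and cB = bcirc_carrier[OF B n]
  have "bcirc E = bcirc A * bcirc B"
  proof (rule eq_matI)
    fix r t assume "r < dim_row (bcirc A * bcirc B)" "t < dim_col (bcirc A * bcirc B)"
    hence r: "r < a * n" and t: "t < c * n" using cA cB by auto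
    hence a: "0 < a" and c: "0 < c" by (cases a; simp)(use t in \<open>cases c; simp\<close>)
    let ?i = "r div a" and ?j = "t div c"
    have i: "?i < n" and j: "?j < n"
      using r t a c by (simp_all add: div_less_iff_less_mult mult.commute)
    have bl: "v + l * b < b * n" if "v < b" "l < n" for v l
    proof -
      have "v + l * b < Suc l * b" using that by simp
      also have "\<dots> \<le> n * b" using that by (intro mult_right_mono) auto
      finally show ?thesis by (simp add: mult.commute)
    qed
    have k1: "(?i + n - (l + ?j) mod n) mod n = ((?i + n - ?j) mod n + n - l) mod n"
      if "l < n" for l
    proof -
      have m: "(l + ?j) mod n \<le> n" using n by (simp add: less_imp_le)
      have "int ((?i + n - (l + ?j) mod n) mod n) = (int ?i + int n - (int l + int ?j) mod int n) mod int n"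
        using m by (simp add: of_nat_diff zmod_int trans_le_add2)
      also have "\<dots> = (int ?i - int l - int ?j + int n) mod int n"
        by (simp add: mod_simps algebra_simps)
      also have "\<dots> = (int ?i - int l - int ?j + int n + int n) mod int n"
        by (rule mod_add_self2[symmetric])
      also have "\<dots> = ((int ?i + int n - int ?j) mod int n + (int n - int l)) mod int n"
        unfolding mod_add_left_eq by (simp add: algebra_simps)
      also have "\<dots> = ((int ?i + int n - int ?j) mod int n + int n - int l) mod int n"
        by (simp add: algebra_simps)
      also have "\<dots> = int (((?i + n - ?j) mod n + n - l) mod n)"
        using j that by (simp add: of_nat_diff zmod_int trans_le_add2)
      finally show ?thesis by simp
    qed
    have k2: "((l + ?j) mod n + n - ?j) mod n = l" if "l < n" for l
    proof -
      have "((l + ?j) mod n + n - ?j) = (l + ?j) mod n + (n - ?j)" using j by simp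
      hence "((l + ?j) mod n + n - ?j) mod n = (l + ?j + (n - ?j)) mod n"
        by (simp add: mod_add_left_eq)
      thus ?thesis using that j by simp
    qed
    have "(bcirc A * bcirc B) $$ (r, t) = (\<Sum>s<b * n. bcirc A $$ (r, s) * bcirc B $$ (s, t))"
      using r t cA cB by (auto simp: scalar_prod_def atLeast0LessThan intro!: sum.cong)
    also have "\<dots> = (\<Sum>l<n. \<Sum>v<b. bcirc A $$ (r, v + l * b) * bcirc B $$ (v + l * b, t))"
      by (rule sum_blocks)
    also have "\<dots> = (\<Sum>l<n. \<Sum>v<b. A ! ((?i + n - l) mod n) $$ (r mod a, v) *
        B ! ((l + n - ?j) mod n) $$ (v, t mod c))"
      by (intro sum.cong refl) (simp add: bl bcirc_index[OF A n r] bcirc_index[OF B n _ t])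
    also have "\<dots> = (\<Sum>l<n. \<Sum>v<b. A ! ((?i + n - (l + ?j) mod n) mod n) $$ (r mod a, v) *
        B ! (((l + ?j) mod n + n - ?j) mod n) $$ (v, t mod c))"
      by (rule sum_cyclic_shift[OF j])
    also have "\<dots> = (\<Sum>l<n. \<Sum>v<b. A ! (((?i + n - ?j) mod n + n - l) mod n) $$ (r mod a, v) *
        B ! l $$ (v, t mod c))"
      by (intro sum.cong refl) (simp add: k1 k2)
    also have "\<dots> = bcirc E $$ (r, t)"
      unfolding bcirc_index[OF E n r t] using n a c by (simp add: E_def)
    finally show "bcirc E $$ (r, t) = (bcirc A * bcirc B) $$ (r, t)" by simp
  qed (use bcirc_carrier[OF E n] cA cB in auto)
  from tensor_of_bcirc[OF E n this] E this
  show "A \<star> B \<in> tensors a c n" "bcirc (A \<star> B) = bcirc A * bcirc B"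
    by (simp_all add: t_prod_def tensorsD[OF A n] tensorsD[OF B n])
qed

end

theory Submission
  imports Defs
begin

text \<open>
  Since \<open>bcirc\<close> is injective and turns the operations on tensors into those on matrices, every
  condition can be read as one on block circulant matrices. Three observations then suffice.

  An outer inverse is determined by its range and null space: if \<open>X\<close> and \<open>Y\<close> are outer inverses
  of \<open>A\<close>, then \<open>X A\<close> fixes the range of \<open>X\<close>, so \<open>R(Y) \<subseteq> R(X)\<close> gives \<open>X A Y = Y\<close>, while
  \<open>Y (1 - A Y) = 0\<close> and \<open>N(Y) \<subseteq> N(X)\<close> give \<open>X = X A Y\<close> (\<open>outer_inverse_mat_unique\<close>).

  Every Moore-Penrose inverse of \<open>S\<close> is an outer inverse with the range and null space of \<open>S\<^sup>*\<close>, and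
  every Drazin inverse of \<open>T\<close> one with those of \<open>T\<^sup>k\<close>. The reason is that each of the two matrices
  is a multiple of the other, both from the left and from the right
  (\<open>moore_penrose_range_null\<close>, \<open>drazin_range_null\<close>). Together with the first observation this
  yields uniqueness of all four objects and the two identities, once the Moore-Penrose and the
  Drazin inverse are known to exist.

  Existence is the substantial part, since the inverses have to be block circulant again. They are
  therefore built from polynomials. A square matrix \<open>W\<close> satisfies a nontrivial polynomial
  equation; solving it for the lowest power that occurs gives \<open>W\<^sup>m = W\<^sup>m\<^sup>+\<^sup>1 Q\<close> with \<open>Q\<close> a polynomial
  in \<open>W\<close> (\<open>strongly_pi_regular\<close>), and polynomials in a block circulant matrix are block circulant.
  For \<open>W = S\<^sup>* S\<close> the exponent can be lowered, because \<open>A\<^sup>* A Y = A\<^sup>* A Z\<close> implies \<open>A Y = A Z\<close>; the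
  result is \<open>S (S\<^sup>* S Q) = S\<close>, which makes \<open>Q S\<^sup>*\<close> the Moore-Penrose inverse. For \<open>W = T\<close> the
  stabilisation of the rank at the index \<open>k\<close> lowers the exponent to \<open>k\<close>, and \<open>T\<^sup>k Q\<^sup>k\<^sup>+\<^sup>1\<close> is the Drazin
  inverse.
\<close>

section \<open>Matrix preliminaries\<close>

text \<open>Premises on dimensions, unlike membership in carriers, determine all variables of the rule, so
  that the simplifier can use it to reassociate products of rectangular matrices.\<close>

lemma mult_mat_assoc_dim:
  "dim_col A = dim_row B \<Longrightarrow> dim_col B = dim_row C \<Longrightarrow> A * B * C = A * (B * (C :: 'a::semiring_0 mat))"
  by (rule assoc_mult_mat[of A "dim_row A" "dim_col A" B "dim_col B" C "dim_col C"]) auto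

lemma pow_mat_commute:
  assumes "A \<in> carrier_mat N N" "B \<in> carrier_mat N N" "A * B = B * A"
  shows "A * B ^\<^sub>m k = B ^\<^sub>m k * (A :: 'a::semiring_1 mat)"
proof (induction k)
  case (Suc k)
  have "A * (B ^\<^sub>m k * B) = (A * B ^\<^sub>m k) * B"
    using assms by (simp add: mult_mat_assoc_dim)
  also have "\<dots> = B ^\<^sub>m k * (A * B)" using assms by (simp add: Suc mult_mat_assoc_dim)
  finally show ?case using assms by (simp add: mult_mat_assoc_dim)
qed (use assms in simp)

lemma pow_mat_Suc_left:
  assumes "A \<in> carrier_mat N N"
  shows "A ^\<^sub>m Suc k = A * (A :: 'a::semiring_1 mat) ^\<^sub>m k"
  using pow_mat_commute[OF assms assms refl, of k] by simp

lemma pow_mat_add: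
  assumes "A \<in> carrier_mat N N"
  shows "A ^\<^sub>m (j + k) = A ^\<^sub>m j * (A :: 'a::semiring_1 mat) ^\<^sub>m k"
  using assms by (induction k) (simp_all add: mult_mat_assoc_dim)

lemma adjoint_carrier:
  "A \<in> carrier_mat a b \<Longrightarrow> mat_adjoint A \<in> carrier_mat b a"
  "dim_row (mat_adjoint A) = dim_col A" "dim_col (mat_adjoint A) = dim_row A"
  by (auto simp: mat_adjoint_def)

lemma adjoint_index:
  "i < dim_col A \<Longrightarrow> j < dim_row A \<Longrightarrow> mat_adjoint A $$ (i, j) = conjugate (A $$ (j, i))"
  by (simp add: mat_adjoint_def mat_of_rows_index)

lemma adjoint_adjoint: "mat_adjoint (mat_adjoint A) = A"
  by (rule eq_matI) (auto simp: adjoint_carrier adjoint_index)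

lemma adjoint_mult:
  fixes A B :: "complex mat"
  assumes "dim_col A = dim_row B"
  shows "mat_adjoint (A * B) = mat_adjoint B * mat_adjoint A"
  by (rule eq_matI)
    (use assms in \<open>auto simp: adjoint_carrier adjoint_index scalar_prod_def mult.commute intro!: sum.cong\<close>)

text \<open>The diagonal entries of \<open>A\<^sup>* A\<close> are the squared norms of the columns of \<open>A\<close>.\<close>

lemma adjoint_mult_self_eq_0:
  fixes A :: "complex mat"
  assumes A: "A \<in> carrier_mat a b" and zero: "mat_adjoint A * A = 0\<^sub>m b b"
  shows "A = 0\<^sub>m a b"
proof (rule eq_matI)
  fix i j assume "i < dim_row (0\<^sub>m a b :: complex mat)" "j < dim_col (0\<^sub>m a b :: complex mat)"
  hence i: "i < a" and j: "j < b" by auto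
  have "complex_of_real (\<Sum>l<a. (cmod (A $$ (l, j)))\<^sup>2) = (\<Sum>l<a. cnj (A $$ (l, j)) * A $$ (l, j))"
    unfolding of_real_sum by (intro sum.cong refl) (metis complex_norm_square mult.commute)
  also have "\<dots> = (mat_adjoint A * A) $$ (j, j)"
    using A j by (auto simp: scalar_prod_def adjoint_carrier adjoint_index atLeast0LessThan)
  also have "\<dots> = 0" using zero j by simp
  finally have "(\<Sum>l<a. (cmod (A $$ (l, j)))\<^sup>2) = 0" using of_real_eq_0_iff by blast
  hence "(cmod (A $$ (i, j)))\<^sup>2 = 0" using i by (subst (asm) sum_nonneg_eq_0_iff) auto
  thus "A $$ (i, j) = 0\<^sub>m a b $$ (i, j)" using i j by simp
qed (use A in auto)

text \<open>With \<open>D = A (Y - Z)\<close> the hypothesis reads \<open>A\<^sup>* D = 0\<close>, whence \<open>D\<^sup>* D = (Y - Z)\<^sup>* A\<^sup>* D = 0\<close>.\<close>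

lemma adjoint_mult_cancel:
  fixes A :: "complex mat"
  assumes A: "A \<in> carrier_mat a b" and Y: "Y \<in> carrier_mat b c" and Z: "Z \<in> carrier_mat b c"
    and eq: "mat_adjoint A * (A * Y) = mat_adjoint A * (A * Z)"
  shows "A * Y = A * Z"
proof -
  let ?D = "A * (Y - Z)"
  have D: "?D = A * Y - A * Z" using A Y Z by (rule mult_minus_distrib_mat)
  have "mat_adjoint A * ?D = mat_adjoint A * (A * Y) - mat_adjoint A * (A * Z)"
    unfolding D by (rule mult_minus_distrib_mat) (use A Y Z in \<open>auto intro: adjoint_carrier\<close>)
  also have "\<dots> = 0\<^sub>m b c" unfolding eq using A Y Z by (intro eq_matI) (auto simp: adjoint_carrier)
  finally have "mat_adjoint ?D * ?D = 0\<^sub>m c c"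
    using A Y Z adjoint_carrier(1)[of "Y - Z" b c] by (simp add: adjoint_mult mult_mat_assoc_dim adjoint_carrier)
  moreover have "?D \<in> carrier_mat a c" using A Y Z by auto
  ultimately have zero: "A * Y - A * Z = 0\<^sub>m a c"
    using adjoint_mult_self_eq_0[of ?D a c] D by simp
  show ?thesis
  proof (rule eq_matI)
    fix i j assume "i < dim_row (A * Z)" "j < dim_col (A * Z)"
    thus "(A * Y) $$ (i, j) = (A * Z) $$ (i, j)"
      using arg_cong[OF zero, of "\<lambda>M. M $$ (i, j)"] A Y Z by simp
  qed (use A Y Z in auto)
qed

section \<open>Column spaces and kernels\<close>

text \<open>The columns of \<open>Z\<close> are preimages under \<open>Y\<close> of the columns of \<open>X\<close>.\<close>

lemma col_space_subset_iff:
  fixes X Y :: "'a::field mat"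
  assumes X: "X \<in> carrier_mat b c" and Y: "Y \<in> carrier_mat b d"
  shows "vec_space.col_space b X \<subseteq> vec_space.col_space b Y \<longleftrightarrow>
    (\<exists>Z \<in> carrier_mat d c. X = Y * Z)"
proof
  assume sub: "vec_space.col_space b X \<subseteq> vec_space.col_space b Y"
  have "\<exists>z\<in>carrier_vec d. Y *\<^sub>v z = col X j" if "j < c" for j
  proof -
    have eq: "X *\<^sub>v unit_vec c j = col X j"
      by (rule eq_vecI) (use X that in \<open>simp_all add: scalar_prod_right_unit\<close>)
    have "\<exists>x\<in>carrier_vec (dim_col X). X *\<^sub>v x = col X j"
      by (rule bexI[of _ "unit_vec c j"]) (use X eq in simp_all)
    hence "col X j \<in> vec_space.col_space b X"
      unfolding vec_space.col_space_eq[OF X] by simp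
    with sub show ?thesis using Y by (auto simp: vec_space.col_space_eq[OF Y])
  qed
  then obtain z where z: "\<And>j. j < c \<Longrightarrow> z j \<in> carrier_vec d" "\<And>j. j < c \<Longrightarrow> Y *\<^sub>v z j = col X j"
    by metis
  let ?Z = "mat_of_cols d (map z [0..<c])"
  have cZ: "col ?Z j = z j" if "j < c" for j using that z(1) by simp
  have "X = Y * ?Z"
  proof (rule mat_col_eqI)
    fix j assume "j < dim_col (Y * ?Z)"
    hence j: "j < c" by simp
    have "col (Y * ?Z) j = Y *\<^sub>v col ?Z j" using j Y by (intro col_mult2) auto
    thus "col X j = col (Y * ?Z) j" using z(2) cZ j by simp
  qed (use X Y in auto)
  thus "\<exists>Z \<in> carrier_mat d c. X = Y * Z" by (intro bexI[of _ ?Z]) auto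
next
  assume "\<exists>Z \<in> carrier_mat d c. X = Y * Z"
  then obtain Z where Z: "Z \<in> carrier_mat d c" "X = Y * Z" by blast
  show "vec_space.col_space b X \<subseteq> vec_space.col_space b Y"
  proof
    fix y assume "y \<in> vec_space.col_space b X"
    then obtain x where "x \<in> carrier_vec c" "y = X *\<^sub>v x" "y \<in> carrier_vec b"
      using X by (auto simp: vec_space.col_space_eq[OF X])
    moreover from this have "y = Y *\<^sub>v (Z *\<^sub>v x)" using Y Z by simp
    ultimately show "y \<in> vec_space.col_space b Y"
      using Y Z by (auto simp: vec_space.col_space_eq[OF Y] intro!: bexI[of _ "Z *\<^sub>v x"])
  qed
qed

lemma kernel_mult_subset:
  assumes "X \<in> carrier_mat b a" "Z \<in> carrier_mat c b"
  shows "mat_kernel X \<subseteq> mat_kernel (Z * (X :: 'a::field mat))"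
  using assms by (auto simp: mat_kernel_def)

text \<open>The columns of \<open>M - M'\<close> lie in the kernel of \<open>Y\<close>, hence in that of \<open>X\<close>.\<close>

lemma kernel_subset_cancel:
  fixes X Y :: "'a::field mat"
  assumes X: "X \<in> carrier_mat b a" and Y: "Y \<in> carrier_mat c a"
    and sub: "mat_kernel Y \<subseteq> mat_kernel X"
    and M: "M \<in> carrier_mat a d" and M': "M' \<in> carrier_mat a d"
    and eq: "Y * M = Y * M'"
  shows "X * M = X * M'"
proof (rule mat_col_eqI)
  fix j assume "j < dim_col (X * M')"
  hence j: "j < d" using M' by simp
  let ?v = "col M j - col M' j"
  have cols: "col M j \<in> carrier_vec a" "col M' j \<in> carrier_vec a" using M M' by auto
  have "Y *\<^sub>v col M j = Y *\<^sub>v col M' j"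
    using col_mult2[OF Y M j] col_mult2[OF Y M' j] eq by simp
  hence "?v \<in> mat_kernel Y"
    using cols Y by (auto simp: mat_kernel_def mult_minus_distrib_mat_vec[OF Y])
  with sub have "X *\<^sub>v ?v = 0\<^sub>v b" using X by (auto simp: mat_kernel_def)
  hence "X *\<^sub>v col M j - X *\<^sub>v col M' j = 0\<^sub>v b"
    using cols by (simp add: mult_minus_distrib_mat_vec[OF X])
  hence *: "(X *\<^sub>v col M j - X *\<^sub>v col M' j) $ i = 0" if "i < b" for i using that by simp
  have "X *\<^sub>v col M j = X *\<^sub>v col M' j"
    by (rule eq_vecI) (use * X in auto)
  thus "col (X * M) j = col (X * M') j"
    using col_mult2[OF X M j] col_mult2[OF X M' j] by simp
qed (use X M M' in auto)

text \<open>A maximal independent set of columns of \<open>B\<close> lies in the column space of \<open>A\<close> and has as many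
  elements as its dimension, so it spans that space.\<close>

lemma rank_eq_imp_col_space_eq:
  fixes A B :: "'a::field mat"
  assumes A: "A \<in> carrier_mat n a" and B: "B \<in> carrier_mat n b"
    and sub: "vec_space.col_space n B \<subseteq> vec_space.col_space n A"
    and rank: "vec_space.rank n B = vec_space.rank n A"
  shows "vec_space.col_space n B = vec_space.col_space n A"
proof -
  interpret vec_space "TYPE('a)" n .
  let ?W = "span (set (cols A))"
  have cA: "set (cols A) \<subseteq> carrier_vec n" and cB: "set (cols B) \<subseteq> carrier_vec n"
    using A B cols_dim by blast+
  have vsW: "vectorspace class_ring (vs ?W)"
    using span_is_subspace[THEN subspace_is_vs, of "set (cols A)"] cA by auto
  have sm: "submodule class_ring ?W V" using cA by (simp add: span_is_submodule)
  obtain U where U: "finite U" "maximal U (\<lambda>T. T \<subseteq> set (cols B) \<and> lin_indpt T)"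
    using maximal_exists_superset[of "set (cols B)" "\<lambda>T. T \<subseteq> set (cols B) \<and> lin_indpt T" "{}"]
      finite_lin_indpt2[of "{}"] by auto
  have UB: "U \<subseteq> set (cols B)" and li: "lin_indpt U" using U(2) by (auto simp: maximal_def)
  have UW: "U \<subseteq> ?W" using UB sub in_own_span[OF cB] by (auto simp: col_space_def)
  have "card U = vectorspace.dim class_ring (vs ?W)"
    using rank_card_indpt[OF B U(2)] rank by (simp add: rank_def)
  hence "vectorspace.basis class_ring (vs ?W) U"
    using vectorspace.dim_li_is_basis[OF vsW _ U(1)] UW li span_li_not_depend(2)[OF UW sm]
      fin_dim_span_cols[OF A] by simp
  hence "span U = ?W"
    using span_li_not_depend(1)[OF UW sm] vectorspace.basis_def[OF vsW] by simp
  moreover have "span U \<subseteq> span (set (cols B))" using UB by (rule span_is_monotone)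
  ultimately show ?thesis using sub by (auto simp: col_space_def)
qed

section \<open>Polynomials in a matrix\<close>

definition matrix_poly :: "nat \<Rightarrow> (nat \<Rightarrow> complex) \<Rightarrow> complex mat \<Rightarrow> complex mat" where
  "matrix_poly d c W = mat (dim_row W) (dim_row W) (\<lambda>(i, j). \<Sum>l<d. c l * (W ^\<^sub>m l) $$ (i, j))"

lemma matrix_poly_carrier: "W \<in> carrier_mat N N \<Longrightarrow> matrix_poly d c W \<in> carrier_mat N N"
  by (auto simp: matrix_poly_def)

lemma mult_matrix_poly_index:
  assumes W: "W \<in> carrier_mat N N" and M: "M \<in> carrier_mat N N" and ij: "i < N" "j < N"
  shows "(M * matrix_poly d c W) $$ (i, j) = (\<Sum>l<d. c l * (M * W ^\<^sub>m l) $$ (i, j))"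
    "(matrix_poly d c W * M) $$ (i, j) = (\<Sum>l<d. c l * (W ^\<^sub>m l * M) $$ (i, j))"
proof -
  have "(M * matrix_poly d c W) $$ (i, j) =
      (\<Sum>t<N. M $$ (i, t) * (\<Sum>l<d. c l * (W ^\<^sub>m l) $$ (t, j)))"
    using W M ij by (auto simp: scalar_prod_def matrix_poly_def atLeast0LessThan intro!: sum.cong)
  also have "\<dots> = (\<Sum>l<d. \<Sum>t<N. M $$ (i, t) * (c l * (W ^\<^sub>m l) $$ (t, j)))"
    unfolding sum_distrib_left by (rule sum.swap)
  also have "\<dots> = (\<Sum>l<d. c l * (M * W ^\<^sub>m l) $$ (i, j))"
    using W M ij by (auto simp: scalar_prod_def atLeast0LessThan sum_distrib_left mult.left_commute
        intro!: sum.cong)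
  finally show "(M * matrix_poly d c W) $$ (i, j) = (\<Sum>l<d. c l * (M * W ^\<^sub>m l) $$ (i, j))" .
  have "(matrix_poly d c W * M) $$ (i, j) =
      (\<Sum>t<N. (\<Sum>l<d. c l * (W ^\<^sub>m l) $$ (i, t)) * M $$ (t, j))"
    using W M ij by (auto simp: scalar_prod_def matrix_poly_def atLeast0LessThan intro!: sum.cong)
  also have "\<dots> = (\<Sum>l<d. \<Sum>t<N. c l * (W ^\<^sub>m l) $$ (i, t) * M $$ (t, j))"
    unfolding sum_distrib_right by (rule sum.swap)
  also have "\<dots> = (\<Sum>l<d. c l * (W ^\<^sub>m l * M) $$ (i, j))"
    using W M ij by (auto simp: scalar_prod_def atLeast0LessThan sum_distrib_left mult.assoc
        intro!: sum.cong)
  finally show "(matrix_poly d c W * M) $$ (i, j) = (\<Sum>l<d. c l * (W ^\<^sub>m l * M) $$ (i, j))" .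
qed

lemma matrix_poly_commute:
  assumes W: "W \<in> carrier_mat N N"
  shows "W * matrix_poly d c W = matrix_poly d c W * W"
proof (rule eq_matI)
  fix i j assume "i < dim_row (matrix_poly d c W * W)" "j < dim_col (matrix_poly d c W * W)"
  hence "i < N" "j < N" using matrix_poly_carrier[OF W, of d c] W by auto
  thus "(W * matrix_poly d c W) $$ (i, j) = (matrix_poly d c W * W) $$ (i, j)"
    by (simp add: mult_matrix_poly_index[OF W W] pow_mat_Suc_left[OF W, simplified])
qed (use matrix_poly_carrier[OF W, of d c] W in auto)

text \<open>The \<open>N\<^sup>2 + 1\<close> powers \<open>W\<^sup>0, \<dots>, W\<^bsup>N*N\<^esup>\<close> live in a space of dimension \<open>N\<^sup>2\<close>. A dependence is found
  as a kernel vector of the matrix whose columns are the vectorised powers, made square by a zero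
  row.\<close>

lemma powers_linearly_dependent:
  fixes W :: "complex mat"
  assumes W: "W \<in> carrier_mat N N"
  obtains c where "\<exists>l \<le> N * N. c l \<noteq> 0"
    "\<And>i j. i < N \<Longrightarrow> j < N \<Longrightarrow> (\<Sum>l\<le>N * N. c l * (W ^\<^sub>m l) $$ (i, j)) = 0"
proof -
  let ?n = "Suc (N * N)"
  \<comment> \<open>Entry \<open>(i, j)\<close> of a power is stored in row \<open>j + i * N\<close>; the last row \<open>N * N\<close> is the zero row.\<close>
  let ?row = "\<lambda>r. vec ?n (\<lambda>l. (W ^\<^sub>m l) $$ (r div N, r mod N))"
  let ?M = "mat\<^sub>r ?n ?n (\<lambda>r. if r = N * N then 0\<^sub>v ?n else ?row r)"
  have "det ?M = 0" by (rule det_row_0) auto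
  then obtain v where v: "v \<in> carrier_vec ?n" "v \<noteq> 0\<^sub>v ?n" "?M *\<^sub>v v = 0\<^sub>v ?n"
    using det_0_iff_vec_prod_zero_field[of ?M ?n] by auto
  have "\<exists>l \<le> N * N. v $ l \<noteq> 0"
  proof (rule ccontr)
    assume "\<not> (\<exists>l \<le> N * N. v $ l \<noteq> 0)"
    hence "v = 0\<^sub>v ?n" using v(1) by (intro eq_vecI) auto
    with v(2) show False ..
  qed
  moreover have "(\<Sum>l\<le>N * N. v $ l * (W ^\<^sub>m l) $$ (i, j)) = 0" if i: "i < N" and j: "j < N" for i j
  proof -
    let ?r = "j + i * N"
    have "?r < Suc i * N" using j by simp
    also have "\<dots> \<le> N * N" using i by (intro mult_right_mono) auto
    finally have r: "?r < N * N" .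
    have "0 = (?M *\<^sub>v v) $ ?r" using v(3) r by simp
    also have "\<dots> = ?row ?r \<bullet> v" using r by simp
    also have "\<dots> = (\<Sum>l\<le>N * N. v $ l * (W ^\<^sub>m l) $$ (i, j))"
      using v(1) i j by (auto simp: scalar_prod_def lessThan_Suc_atMost[symmetric] atLeast0LessThan
          mult.commute intro!: sum.cong)
    finally show ?thesis by simp
  qed
  ultimately show thesis by (rule that)
qed

text \<open>In a dependence \<open>\<Sum>\<^sub>l c\<^sub>l W\<^sup>l = 0\<close> let \<open>c\<^sub>m\<close> be the first nonzero coefficient, and solve for \<open>W\<^sup>m\<close>:
  all remaining terms contain the factor \<open>W\<^sup>m\<^sup>+\<^sup>1\<close>.\<close>

lemma strongly_pi_regular:
  fixes W :: "complex mat"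
  assumes W: "W \<in> carrier_mat N N"
  obtains m d c where "W ^\<^sub>m m = W ^\<^sub>m Suc m * matrix_poly d c W"
proof -
  obtain c where c: "\<exists>l \<le> N * N. c l \<noteq> 0"
    "\<And>i j. i < N \<Longrightarrow> j < N \<Longrightarrow> (\<Sum>l\<le>N * N. c l * (W ^\<^sub>m l) $$ (i, j)) = 0"
    by (rule powers_linearly_dependent[OF W]) blast
  define m where "m = (LEAST l. c l \<noteq> 0)"
  have cm: "c m \<noteq> 0" unfolding m_def using c(1) LeastI_ex[of "\<lambda>l. c l \<noteq> 0"] by blast
  have below: "c l = 0" if "l < m" for l
    using not_less_Least[of l "\<lambda>l. c l \<noteq> 0"] that unfolding m_def by blast
  have m: "m \<le> N * N"
  proof -
    obtain l where "l \<le> N * N" "c l \<noteq> 0" using c(1) by blast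
    thus ?thesis using below[of l] by linarith
  qed
  define d where "d = N * N - m"
  let ?e = "\<lambda>l. - c (Suc m + l) / c m"
  have "W ^\<^sub>m m = W ^\<^sub>m Suc m * matrix_poly d ?e W"
  proof (rule eq_matI)
    fix i j
    assume "i < dim_row (W ^\<^sub>m Suc m * matrix_poly d ?e W)"
      "j < dim_col (W ^\<^sub>m Suc m * matrix_poly d ?e W)"
    hence i: "i < N" and j: "j < N" using matrix_poly_carrier[OF W, of d ?e] W by auto
    let ?f = "\<lambda>l. c l * (W ^\<^sub>m l) $$ (i, j)"
    have "0 = sum ?f {..N * N}" using c(2)[OF i j] by simp
    also have "\<dots> = sum ?f {m..m + d}"
      using m by (intro sum.mono_neutral_right) (auto simp: d_def below not_le)
    also have "\<dots> = ?f m + sum ?f {Suc m..m + d}" by (simp add: sum.atLeast_Suc_atMost)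
    also have "sum ?f {Suc m..m + d} = (\<Sum>l<d. ?f (Suc m + l))"
      by (rule sum.reindex_bij_witness[of _ "\<lambda>l. Suc m + l" "\<lambda>l. l - Suc m"]) auto
    finally have "?f m = - (\<Sum>l<d. ?f (Suc m + l))"
      unfolding eq_neg_iff_add_eq_0 by (rule sym)
    hence "(W ^\<^sub>m m) $$ (i, j) = - (\<Sum>l<d. ?f (Suc m + l)) / c m"
      using cm by (metis nonzero_mult_div_cancel_left)
    also have "\<dots> = (\<Sum>l<d. ?e l * (W ^\<^sub>m (Suc m + l)) $$ (i, j))"
      unfolding sum_negf[symmetric] sum_divide_distrib
      by (rule sum.cong) (simp_all del: pow_mat.simps)
    also have "\<dots> = (W ^\<^sub>m Suc m * matrix_poly d ?e W) $$ (i, j)"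
      using i j W unfolding pow_mat_add[OF W] by (subst mult_matrix_poly_index[OF W]) auto
    finally show "(W ^\<^sub>m m) $$ (i, j) = (W ^\<^sub>m Suc m * matrix_poly d ?e W) $$ (i, j)" .
  qed (use matrix_poly_carrier[OF W, of d ?e] W in auto)
  thus thesis by (rule that)
qed

section \<open>Generalized inverses of matrices\<close>

lemma outer_inverse_mat_unique:
  fixes A X Y :: "'a::field mat"
  assumes A: "A \<in> carrier_mat a b" and X: "X \<in> carrier_mat b a" and Y: "Y \<in> carrier_mat b a"
    and XAX: "X * A * X = X" and YAY: "Y * A * Y = Y"
    and range: "vec_space.col_space b Y \<subseteq> vec_space.col_space b X"
    and null: "mat_kernel Y \<subseteq> mat_kernel X"
  shows "X = Y"
proof -
  obtain Z where Z: "Z \<in> carrier_mat a a" "Y = X * Z"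
    using range col_space_subset_iff[OF Y X] by blast
  have "X * (A * Y) = X * A * X * Z" using A X Z by (simp add: mult_mat_assoc_dim)
  hence "X * (A * Y) = Y" unfolding XAX using Z by simp
  moreover have "X * (A * Y) = X * 1\<^sub>m a"
    by (rule kernel_subset_cancel[OF X Y null])
      (use A X Y YAY in \<open>auto simp: mult_mat_assoc_dim\<close>)
  ultimately show ?thesis using X by simp
qed

text \<open>Write \<open>R = S X\<close> and \<open>P = X S\<close>. Then \<open>R = S Q S\<^sup>*\<close> ends with \<open>S\<^sup>*\<close> and
  \<open>P = S\<^sup>* S Q\<close> starts with it. The adjoint of \<open>S X S = S\<close> gives \<open>S\<^sup>* R\<^sup>* = S\<^sup>*\<close> and \<open>P\<^sup>* S\<^sup>* = S\<^sup>*\<close>, hence \<open>R R\<^sup>* = R\<close> and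
  \<open>P\<^sup>* P = P\<close>. So \<open>R\<close> and \<open>P\<close> are Hermitian, although \<open>Q\<close> need not be.\<close>

lemma moore_penrose_mat_exists:
  fixes S Q :: "complex mat"
  assumes S: "S \<in> carrier_mat a b" and Q: "Q \<in> carrier_mat b b"
    and comm: "mat_adjoint S * S * Q = Q * (mat_adjoint S * S)"
    and inner: "S * (mat_adjoint S * S * Q) = S"
  defines "X \<equiv> Q * mat_adjoint S"
  shows "S * X * S = S" "X * S * X = X"
    "mat_adjoint (S * X) = S * X" "mat_adjoint (X * S) = X * S"
proof -
  note dims = S[THEN carrier_matD(1)] S[THEN carrier_matD(2)] Q[THEN carrier_matD(1)]
    Q[THEN carrier_matD(2)] adjoint_carrier(2,3)
  note simps = mult_mat_assoc_dim dims adjoint_mult adjoint_adjoint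
  let ?S' = "mat_adjoint S"
  have XS: "X * S = ?S' * S * Q" using comm by (simp add: X_def simps)
  show SXS: "S * X * S = S"
    using inner XS by (simp add: simps X_def)
  let ?R = "S * X" and ?P = "X * S"
  have adjR: "?S' * mat_adjoint ?R = ?S'"
    using arg_cong[OF SXS, of mat_adjoint] by (simp add: simps X_def)
  have adjP: "mat_adjoint ?P * ?S' = ?S'"
    using arg_cong[OF SXS, of mat_adjoint] by (simp add: simps X_def)
  have "?R * mat_adjoint ?R = S * Q * (?S' * mat_adjoint ?R)" by (simp add: simps X_def)
  also have "\<dots> = ?R" unfolding adjR by (simp add: simps X_def)
  finally have RR: "?R * mat_adjoint ?R = ?R" .
  have "mat_adjoint ?R = mat_adjoint (?R * mat_adjoint ?R)" using RR by simp
  also have "\<dots> = ?R * mat_adjoint ?R"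
    by (subst adjoint_mult) (simp_all add: adjoint_carrier adjoint_adjoint)
  finally show "mat_adjoint ?R = ?R" using RR by simp
  have PM: "M * ?P = M * ?S' * (S * Q)" if "dim_col M = b" for M
    unfolding XS using that by (simp add: simps)
  have "mat_adjoint ?P * ?P = mat_adjoint ?P * ?S' * (S * Q)"
    by (rule PM) (simp add: dims X_def)
  also have "\<dots> = ?P" unfolding adjP by (simp add: XS simps)
  finally have PP: "mat_adjoint ?P * ?P = ?P" .
  have "mat_adjoint ?P = mat_adjoint (mat_adjoint ?P * ?P)" using PP by simp
  also have "\<dots> = mat_adjoint ?P * ?P"
    by (subst adjoint_mult) (simp_all add: adjoint_carrier adjoint_adjoint)
  finally show P: "mat_adjoint ?P = ?P" using PP by simp
  have "X * S * X = Q * (?S' * (S * X))" by (simp add: simps X_def)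
  also have "?S' * (S * X) = ?S'" using adjR \<open>mat_adjoint ?R = ?R\<close> by simp
  finally show "X * S * X = X" by (simp add: X_def)
qed

text \<open>A leading factor \<open>W = W\<^sup>*\<close> can be cancelled as long as another \<open>W\<close> follows it, which brings the
  exponent \<open>m\<close> down to 1. The factor \<open>1\<^sub>m N\<close> gives the equation the shape \<open>W Y = W Z\<close> to which
  \<open>adjoint_mult_cancel\<close> applies again with \<open>W = S\<^sup>* S\<close>.\<close>

lemma hermitian_pi_regular_imp_regular:
  fixes W Q :: "complex mat"
  assumes W: "W \<in> carrier_mat N N" and Q: "Q \<in> carrier_mat N N" and herm: "mat_adjoint W = W"
    and "W ^\<^sub>m m = W ^\<^sub>m Suc m * Q"
  shows "W * 1\<^sub>m N = W * (W * Q)"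
  using assms(4)
proof (induction m)
  case 0
  have "W ^\<^sub>m 0 = 1\<^sub>m N" "W ^\<^sub>m Suc 0 * Q = W * Q" using W Q by simp_all
  thus ?case using 0 by simp
next
  case (Suc m)
  show ?case
  proof (cases m)
    case 0
    have "W ^\<^sub>m Suc m = W * 1\<^sub>m N" "W ^\<^sub>m Suc (Suc m) * Q = W * (W * Q)"
      using 0 W Q by (simp_all add: mult_mat_assoc_dim)
    thus ?thesis using Suc.prems by simp
  next
    case (Suc m')
    have left: "W ^\<^sub>m Suc k * Y = W * (W ^\<^sub>m k * Y)" if "Y \<in> carrier_mat N N" for k Y
      unfolding pow_mat_Suc_left[OF W] using W that by (simp add: mult_mat_assoc_dim)
    have 1: "W ^\<^sub>m Suc k * 1\<^sub>m N = W ^\<^sub>m Suc k" for k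
      by (rule right_mult_one_mat, rule pow_carrier_mat[OF W])
    have 2: "W ^\<^sub>m Suc k * Q = W ^\<^sub>m k * (W * Q)" for k
      using W Q by (simp add: mult_mat_assoc_dim)
    have "W ^\<^sub>m Suc (Suc m') * 1\<^sub>m N = W ^\<^sub>m Suc (Suc m') * (W * Q)"
      using Suc.prems unfolding Suc 1 2 .
    hence "W * (W * (W ^\<^sub>m m' * 1\<^sub>m N)) = W * (W * (W ^\<^sub>m m' * (W * Q)))"
      by (simp only: left one_carrier_mat mult_carrier_mat[OF W Q])
    hence "W * (W ^\<^sub>m m' * 1\<^sub>m N) = W * (W ^\<^sub>m m' * (W * Q))"
      by (intro adjoint_mult_cancel[OF W, of _ N]) (use W Q herm in auto)
    hence "W ^\<^sub>m Suc m' * 1\<^sub>m N = W ^\<^sub>m Suc m' * (W * Q)"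
      by (simp only: left one_carrier_mat mult_carrier_mat[OF W Q])
    hence "W ^\<^sub>m m = W ^\<^sub>m Suc m * Q" unfolding Suc 1 2 .
    thus ?thesis by (rule Suc.IH)
  qed
qed

text \<open>Iterating \<open>stab\<close> gives \<open>T\<^sup>k = T\<^sup>m T\<^sup>k Y\<^sup>m\<close>, and \<open>T Q\<close> acts as the identity on \<open>T\<^sup>m\<close> and commutes with
  powers of \<open>T\<close>. So \<open>T Q\<close> acts as the identity on \<open>T\<^sup>k\<close> as well.\<close>

lemma pi_regular_at_index:
  fixes T Q Y :: "complex mat"
  assumes T: "T \<in> carrier_mat N N" and Q: "Q \<in> carrier_mat N N" and Y: "Y \<in> carrier_mat N N"
    and comm: "T * Q = Q * T"
    and reg: "T ^\<^sub>m m = T ^\<^sub>m Suc m * Q"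
    and stab: "T ^\<^sub>m k = T ^\<^sub>m Suc k * Y"
  shows "T ^\<^sub>m k = T ^\<^sub>m k * (T * Q)"
proof -
  have Yk: "T ^\<^sub>m k = T ^\<^sub>m j * (T ^\<^sub>m k * Y ^\<^sub>m j)" for j
  proof (induction j)
    case (Suc j)
    have "T ^\<^sub>m j * (T ^\<^sub>m k * Y ^\<^sub>m j) = T ^\<^sub>m j * (T ^\<^sub>m Suc k * Y * Y ^\<^sub>m j)"
      by (simp only: stab[symmetric])
    also have "\<dots> = T ^\<^sub>m j * (T * T ^\<^sub>m k * (Y * Y ^\<^sub>m j))"
      using T Y pow_mat_Suc_left[OF T, of k] by (simp add: mult_mat_assoc_dim)
    also have "\<dots> = T ^\<^sub>m Suc j * (T ^\<^sub>m k * Y ^\<^sub>m Suc j)"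
      using T Y pow_mat_Suc_left[OF Y, of j] by (simp add: mult_mat_assoc_dim)
    finally show ?case using Suc by simp
  qed (use T Y in simp)
  have TQ: "T * Q \<in> carrier_mat N N" using T Q by simp
  have "T * (T * Q) = T * Q * T"
    by (simp only: assoc_mult_mat[OF T Q T] comm[symmetric])
  hence comm': "(T * Q) * T ^\<^sub>m j = T ^\<^sub>m j * (T * Q)" for j
    by (intro pow_mat_commute[OF TQ T]) simp
  have "T ^\<^sub>m k * (T * Q) = (T * Q) * T ^\<^sub>m k" by (rule comm'[symmetric])
  also have "\<dots> = (T * Q) * T ^\<^sub>m m * (T ^\<^sub>m k * Y ^\<^sub>m m)"
    by (subst Yk[of m]) (use T Q Y in \<open>simp add: mult_mat_assoc_dim\<close>)
  also have "(T * Q) * T ^\<^sub>m m = T ^\<^sub>m m"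
    unfolding comm' by (subst (2) reg) (use T Q in \<open>simp add: mult_mat_assoc_dim\<close>)
  finally show ?thesis unfolding Yk[of m, symmetric] by (rule sym)
qed

text \<open>\<open>T\<close>, \<open>Q\<close> and \<open>X\<close> commute, and \<open>inner\<close> lets \<open>T\<^sup>k\<close> absorb factors \<open>T Q\<close>; for instance
  \<open>T\<^sup>k\<^sup>+\<^sup>1 X = T\<^sup>k (T Q)\<^sup>k\<^sup>+\<^sup>1 = T\<^sup>k\<close>.\<close>

lemma drazin_mat_exists:
  fixes T Q :: "complex mat"
  assumes T: "T \<in> carrier_mat N N" and Q: "Q \<in> carrier_mat N N"
    and comm: "T * Q = Q * T" and inner: "T ^\<^sub>m k = T ^\<^sub>m k * (T * Q)"
  defines "X \<equiv> T ^\<^sub>m k * Q ^\<^sub>m Suc k"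
  shows "T ^\<^sub>m Suc k * X = T ^\<^sub>m k" "X * T * X = X" "T * X = X * T"
proof -
  have X: "X \<in> carrier_mat N N"
    unfolding X_def by (rule mult_carrier_mat[OF pow_carrier_mat[OF T] pow_carrier_mat[OF Q]])
  note comms = pow_mat_commute[OF T T refl] pow_mat_commute[OF T Q comm]
  have TkQ: "T ^\<^sub>m j * Q = Q * T ^\<^sub>m j" for j
    using pow_mat_commute[OF Q T comm[symmetric]] by simp
  have red: "T ^\<^sub>m k * (T ^\<^sub>m j * Q ^\<^sub>m j) = T ^\<^sub>m k" for j
  proof (induction j)
    case (Suc j)
    have "T ^\<^sub>m Suc j * Q ^\<^sub>m Suc j = T * T ^\<^sub>m j * (Q ^\<^sub>m j * Q)"
      using pow_mat_Suc_left[OF T, of j] by simp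
    also have "\<dots> = (T * Q) * (T ^\<^sub>m j * Q ^\<^sub>m j)"
      using T Q pow_mat_Suc_left[OF Q, of j] TkQ[of j]
      by (simp add: mult_mat_assoc_dim) (simp add: mult_mat_assoc_dim[symmetric])
    finally have "T ^\<^sub>m k * (T ^\<^sub>m Suc j * Q ^\<^sub>m Suc j) = T ^\<^sub>m k * (T * Q) * (T ^\<^sub>m j * Q ^\<^sub>m j)"
      using T Q by (simp add: mult_mat_assoc_dim)
    thus ?case unfolding inner[symmetric] using Suc by (rule trans)
  qed (use T Q in simp)
  have "T ^\<^sub>m Suc k * X = T ^\<^sub>m Suc k * T ^\<^sub>m k * Q ^\<^sub>m Suc k"
    unfolding X_def using T Q by (simp add: mult_mat_assoc_dim)
  also have "T ^\<^sub>m Suc k * T ^\<^sub>m k = T ^\<^sub>m k * T ^\<^sub>m Suc k"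
    unfolding pow_mat_add[OF T, symmetric] by (simp add: add.commute)
  also have "\<dots> * Q ^\<^sub>m Suc k = T ^\<^sub>m k * (T ^\<^sub>m Suc k * Q ^\<^sub>m Suc k)"
    using T Q by (simp add: mult_mat_assoc_dim)
  finally show 1: "T ^\<^sub>m Suc k * X = T ^\<^sub>m k" unfolding red .
  have "T * X = T * T ^\<^sub>m k * Q ^\<^sub>m Suc k" unfolding X_def using T Q by (simp add: mult_mat_assoc_dim)
  also have "\<dots> = T ^\<^sub>m k * (T * Q ^\<^sub>m Suc k)"
    unfolding comms(1) using T Q by (simp add: mult_mat_assoc_dim)
  also have "\<dots> = X * T" unfolding X_def comms(2) using T Q by (simp add: mult_mat_assoc_dim)
  finally show TX: "T * X = X * T" .
  have "X * T * X = X * (T * T ^\<^sub>m k) * Q ^\<^sub>m Suc k"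
    using T Q X by (simp add: X_def mult_mat_assoc_dim)
  also have "\<dots> = T ^\<^sub>m Suc k * X * Q ^\<^sub>m Suc k"
    using pow_mat_commute[OF X T TX[symmetric], of "Suc k"] pow_mat_Suc_left[OF T, of k] by simp
  also have "\<dots> = X" unfolding 1 by (simp only: X_def)
  finally show "X * T * X = X" .
qed

lemma col_space_eqI:
  fixes X Y :: "'a::field mat"
  assumes "X \<in> carrier_mat b c" "Y \<in> carrier_mat b d" "U \<in> carrier_mat d c" "V \<in> carrier_mat c d"
    and "X = Y * U" "Y = X * V"
  shows "vec_space.col_space b X = vec_space.col_space b Y"
  unfolding set_eq_subset col_space_subset_iff[OF assms(1,2)] col_space_subset_iff[OF assms(2,1)]
  by (intro conjI bexI[of _ U] bexI[of _ V] assms)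

lemma kernel_eqI:
  fixes X Y :: "'a::field mat"
  assumes "X \<in> carrier_mat b c" "Y \<in> carrier_mat d c" "U \<in> carrier_mat b d" "V \<in> carrier_mat d b"
    and "X = U * Y" "Y = V * X"
  shows "mat_kernel X = mat_kernel Y"
  using kernel_mult_subset[OF assms(1,4), folded assms(6)]
    kernel_mult_subset[OF assms(2,3), folded assms(5)]
  by (rule subset_antisym)

text \<open>The Penrose equations give \<open>X = S\<^sup>* X\<^sup>* X = X X\<^sup>* S\<^sup>*\<close> and \<open>S\<^sup>* = X S S\<^sup>* = S\<^sup>* S X\<close>.\<close>

lemma moore_penrose_range_null:
  fixes S X :: "complex mat"
  assumes S: "S \<in> carrier_mat a b" and X: "X \<in> carrier_mat b a"
    and SXS: "S * X * S = S" and XSX: "X * S * X = X"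
    and SX: "mat_adjoint (S * X) = S * X" and XS: "mat_adjoint (X * S) = X * S"
  shows "vec_space.col_space b X = vec_space.col_space b (mat_adjoint S)"
    "mat_kernel X = mat_kernel (mat_adjoint S)"
proof -
  let ?S' = "mat_adjoint S" and ?X' = "mat_adjoint X"
  have S': "?S' \<in> carrier_mat b a" and X': "?X' \<in> carrier_mat a b"
    using S X by (auto intro: adjoint_carrier)
  have SX': "S * X = ?X' * ?S'" and XS': "X * S = ?S' * ?X'"
    using SX XS S X by (simp_all add: adjoint_mult)
  have 1: "X = ?S' * (?X' * X)"
    using XSX unfolding XS' using S' X X' by (simp add: mult_mat_assoc_dim)
  have 2: "X = X * ?X' * ?S'"
    using XSX S' X X' S by (simp add: mult_mat_assoc_dim SX')
  have "?S' = mat_adjoint (S * (X * S))" using SXS S X by (simp add: mult_mat_assoc_dim)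
  also have "\<dots> = X * S * ?S'" using S X by (subst adjoint_mult) (simp_all add: XS)
  also have "\<dots> = X * (S * ?S')" using S X S' by (simp add: mult_mat_assoc_dim)
  finally have 3: "?S' = X * (S * ?S')" .
  have "?S' = mat_adjoint (S * X * S)" using SXS by simp
  also have "\<dots> = ?S' * (S * X)" using S X by (subst adjoint_mult) (simp_all add: SX)
  also have "\<dots> = ?S' * S * X" using S X S' by (simp add: mult_mat_assoc_dim)
  finally have 4: "?S' = ?S' * S * X" .
  show "vec_space.col_space b X = vec_space.col_space b ?S'"
    by (rule col_space_eqI[OF X S' _ _ 1 3]) (use S X S' X' in auto)
  show "mat_kernel X = mat_kernel ?S'"
    by (rule kernel_eqI[OF X S' _ _ 2 4]) (use S X S' X' in auto)
qed

text \<open>Iterating \<open>X = T X X\<close> gives \<open>X = T\<^sup>k X\<^sup>k\<^sup>+\<^sup>1 = X\<^sup>k\<^sup>+\<^sup>1 T\<^sup>k\<close>; conversely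
  \<open>T\<^sup>k = T\<^sup>k\<^sup>+\<^sup>1 X = X T\<^sup>k\<^sup>+\<^sup>1\<close>.\<close>

lemma drazin_range_null:
  fixes T X :: "complex mat"
  assumes T: "T \<in> carrier_mat N N" and X: "X \<in> carrier_mat N N"
    and k: "T ^\<^sub>m Suc k * X = T ^\<^sub>m k" and XTX: "X * T * X = X" and TX: "T * X = X * T"
  shows "vec_space.col_space N X = vec_space.col_space N (T ^\<^sub>m k)"
    "mat_kernel X = mat_kernel (T ^\<^sub>m k)"
proof -
  have Tj: "T ^\<^sub>m j \<in> carrier_mat N N" and Xj: "X ^\<^sub>m j \<in> carrier_mat N N" for j
    using T X by simp_all
  have TXX: "T * (X * X) = X"
    unfolding assoc_mult_mat[OF T X X, symmetric] TX by (rule XTX)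
  have 1: "X = T ^\<^sub>m j * X ^\<^sub>m Suc j" for j
  proof (induction j)
    case (Suc j)
    have "T ^\<^sub>m j * X ^\<^sub>m Suc j = T ^\<^sub>m j * (X * X ^\<^sub>m j)"
      by (simp only: pow_mat_Suc_left[OF X])
    also have "\<dots> = T ^\<^sub>m j * (T * (X * X) * X ^\<^sub>m j)" by (simp only: TXX)
    also have "\<dots> = T ^\<^sub>m Suc j * (X * (X * X ^\<^sub>m j))"
      using T X by (simp add: mult_mat_assoc_dim)
    also have "\<dots> = T ^\<^sub>m Suc j * X ^\<^sub>m Suc (Suc j)"
      by (simp only: pow_mat_Suc_left[OF X])
    finally show ?case by (rule trans[OF Suc])
  next
    case 0
    show ?case using T X by simp
  qed
  have comm: "X * T ^\<^sub>m j = T ^\<^sub>m j * X" for j by (rule pow_mat_commute[OF X T TX[symmetric]])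
  have 2: "X = X ^\<^sub>m Suc k * T ^\<^sub>m k"
    using 1[of k] pow_mat_commute[OF Tj X comm[symmetric], of k "Suc k"] by (rule trans)
  have 3: "T ^\<^sub>m k = X * T ^\<^sub>m Suc k" unfolding comm by (rule k[symmetric])
  show "vec_space.col_space N X = vec_space.col_space N (T ^\<^sub>m k)"
    by (rule col_space_eqI[OF X Tj Xj Tj 1 3])
  show "mat_kernel X = mat_kernel (T ^\<^sub>m k)"
    by (rule kernel_eqI[OF X Tj Xj Tj 2 k[symmetric]])
qed

section \<open>Tensors and their block circulant matrices\<close>

lemma bcirc_eq_iff:
  assumes "A \<in> tensors a b n" "B \<in> tensors a b n" "0 < n"
  shows "A = B \<longleftrightarrow> bcirc A = bcirc B"
  using bcirc_inj[OF assms(1,2,3)] by blast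

lemma bcirc_t_pow:
  assumes T: "T \<in> tensors p p n" and n: "0 < n"
  shows "t_pow T k \<in> tensors p p n" "bcirc (t_pow T k) = bcirc T ^\<^sub>m k"
proof (induction k)
  case 0
  show "t_pow T 0 \<in> tensors p p n" "bcirc (t_pow T 0) = bcirc T ^\<^sub>m 0"
    using bcirc_t_one[OF n, of p] bcirc_carrier[OF T n] tensorsD[OF T n] by auto
next
  case (Suc k)
  show "t_pow T (Suc k) \<in> tensors p p n" "bcirc (t_pow T (Suc k)) = bcirc T ^\<^sub>m Suc k"
    using bcirc_t_prod[OF Suc(1) T n] Suc(2) by simp_all
qed

lemma bcirc_linear_combination:
  assumes E: "\<And>l. E l \<in> tensors a b n" and n: "0 < n"
  shows "\<exists>F \<in> tensors a b n. bcirc F =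
    mat (a * n) (b * n) (\<lambda>(r, s). \<Sum>l<(d::nat). c l * bcirc (E l) $$ (r, s))"
proof -
  define F where "F = map (\<lambda>k. mat a b (\<lambda>(i, j). \<Sum>l<d. c l * (E l ! k) $$ (i, j))) [0..<n]"
  have F: "F \<in> tensors a b n" unfolding F_def by (rule tensors_map) auto
  have "bcirc F = mat (a * n) (b * n) (\<lambda>(r, s). \<Sum>l<d. c l * bcirc (E l) $$ (r, s))"
  proof (rule eq_matI; simp?)
    fix r s assume r: "r < a * n" and s: "s < b * n"
    hence "0 < a" "0 < b" by (auto intro: gr0I)
    thus "bcirc F $$ (r, s) = (\<Sum>l<d. c l * bcirc (E l) $$ (r, s))"
      unfolding bcirc_index[OF F n r s] bcirc_index[OF E n r s] using n by (simp add: F_def)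
  qed (use bcirc_carrier[OF F n] in auto)
  with F show ?thesis by blast
qed

text \<open>A polynomial in \<open>bcirc T\<close> is a linear combination of the matrices of the powers of \<open>T\<close>, so the
  factor \<open>Q\<close> can be taken to be a tensor. This is what keeps the inverses below block circulant.\<close>

lemma tensor_strongly_pi_regular:
  assumes T: "T \<in> tensors p p n" and n: "0 < n"
  obtains m Q where "Q \<in> tensors p p n" "bcirc T * bcirc Q = bcirc Q * bcirc T"
    "bcirc T ^\<^sub>m m = bcirc T ^\<^sub>m Suc m * bcirc Q"
proof -
  note cT = bcirc_carrier[OF T n]
  obtain m d c where reg: "bcirc T ^\<^sub>m m = bcirc T ^\<^sub>m Suc m * matrix_poly d c (bcirc T)"
    by (rule strongly_pi_regular[OF cT])
  obtain Q where Q: "Q \<in> tensors p p n" "bcirc Q = matrix_poly d c (bcirc T)"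
    using bcirc_linear_combination[where E = "t_pow T", OF bcirc_t_pow(1)[OF T n] n, where d = d and c = c] cT
    by (auto simp: matrix_poly_def bcirc_t_pow(2)[OF T n])
  show thesis
    by (rule that[OF Q(1), of m]) (simp_all only: Q(2) reg[symmetric] matrix_poly_commute[OF cT])
qed

section \<open>The generalized inverses of tensors\<close>

lemma is_mp_inverse_iff:
  assumes S: "S \<in> tensors p q n" and n: "0 < n"
  shows "is_mp_inverse S X \<longleftrightarrow> X \<in> tensors q p n \<and>
    bcirc S * bcirc X * bcirc S = bcirc S \<and> bcirc X * bcirc S * bcirc X = bcirc X \<and>
    mat_adjoint (bcirc S * bcirc X) = bcirc S * bcirc X \<and>
    mat_adjoint (bcirc X * bcirc S) = bcirc X * bcirc S"
proof (cases "X \<in> tensors q p n")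
  case X: True
  note SX = bcirc_t_prod[OF S X n] and XS = bcirc_t_prod[OF X S n]
  note SXS = bcirc_t_prod[OF SX(1) S n] and XSX = bcirc_t_prod[OF XS(1) X n]
  note adj = bcirc_t_adjoint[OF SX(1) n] bcirc_t_adjoint[OF XS(1) n]
  show ?thesis
    unfolding is_mp_inverse_def bcirc_eq_iff[OF SXS(1) S n] bcirc_eq_iff[OF XSX(1) X n]
      bcirc_eq_iff[OF adj(1) SX(1) n] bcirc_eq_iff[OF adj(3) XS(1) n]
    using X by (simp add: SX XS SXS XSX adj tensorsD[OF S n])
qed (simp add: is_mp_inverse_def tensorsD[OF S n])

lemma is_drazin_inverse_iff:
  assumes T: "T \<in> tensors p p n" and n: "0 < n"
  shows "is_drazin_inverse T X \<longleftrightarrow> X \<in> tensors p p n \<and>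
    bcirc T ^\<^sub>m Suc (t_index T) * bcirc X = bcirc T ^\<^sub>m t_index T \<and>
    bcirc X * bcirc T * bcirc X = bcirc X \<and> bcirc T * bcirc X = bcirc X * bcirc T"
proof (cases "X \<in> tensors p p n")
  case X: True
  note TX = bcirc_t_prod[OF T X n] and XT = bcirc_t_prod[OF X T n]
  note XTX = bcirc_t_prod[OF XT(1) X n]
  note pow = bcirc_t_pow[OF T n]
  note powX = bcirc_t_prod[OF pow(1) X n]
  show ?thesis
    unfolding is_drazin_inverse_def bcirc_eq_iff[OF powX(1) pow(1) n]
      bcirc_eq_iff[OF XTX(1) X n] bcirc_eq_iff[OF TX(1) XT(1) n]
    using X by (simp add: TX XT XTX pow(2) powX(2) tensorsD[OF T n] del: t_pow.simps)
qed (simp add: is_drazin_inverse_def tensorsD[OF T n])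

lemma is_outer_inverse_iff:
  assumes A: "A \<in> tensors a b n" and n: "0 < n"
  shows "is_outer_inverse A R N X \<longleftrightarrow> X \<in> tensors b a n \<and>
    bcirc X * bcirc A * bcirc X = bcirc X \<and>
    vec_space.col_space (b * n) (bcirc X) = R \<and> mat_kernel (bcirc X) = N"
proof (cases "X \<in> tensors b a n")
  case X: True
  note XA = bcirc_t_prod[OF X A n]
  note XAX = bcirc_t_prod[OF XA(1) X n]
  show ?thesis
    unfolding is_outer_inverse_def bcirc_eq_iff[OF XAX(1) X n]
    using X bcirc_carrier[OF X n]
    by (simp add: XA XAX tensorsD[OF A n] t_range_def t_null_def)
qed (simp add: is_outer_inverse_def tensorsD[OF A n])

lemma outer_inverse_unique:
  assumes A: "A \<in> tensors a b n" and n: "0 < n"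
    and X: "is_outer_inverse A R N X" and Y: "is_outer_inverse A R N Y"
  shows "X = Y"
proof -
  note X = X[unfolded is_outer_inverse_iff[OF A n]] and Y = Y[unfolded is_outer_inverse_iff[OF A n]]
  have "bcirc X = bcirc Y"
    by (rule outer_inverse_mat_unique[OF bcirc_carrier[OF A n]])
      (use X Y bcirc_carrier[OF _ n] in auto)
  thus ?thesis using bcirc_inj X Y n by blast
qed

text \<open>Cancelling \<open>S\<^sup>*\<close> from \<open>S\<^sup>* S = (S\<^sup>* S) (S\<^sup>* S) Q\<close> leaves \<open>S = S (S\<^sup>* S Q)\<close>.\<close>

lemma mp_inverse_exists:
  assumes S: "S \<in> tensors p q n" and n: "0 < n"
  shows "\<exists>X. is_mp_inverse S X"
proof -
  note S' = bcirc_t_adjoint[OF S n]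
  note W = bcirc_t_prod[OF S'(1) S n]
  note cS = bcirc_carrier[OF S n]
  let ?M = "bcirc S"
  let ?W = "mat_adjoint ?M * ?M"
  have cW: "?W \<in> carrier_mat (q * n) (q * n)" by (rule mult_carrier_mat[OF adjoint_carrier(1)[OF cS] cS])
  obtain m Q where Q: "Q \<in> tensors q q n" "?W * bcirc Q = bcirc Q * ?W"
    "?W ^\<^sub>m m = ?W ^\<^sub>m Suc m * bcirc Q"
    using tensor_strongly_pi_regular[OF W(1) n] unfolding W(2) S'(2) by metis
  note cQ = bcirc_carrier[OF Q(1) n]
  have herm: "mat_adjoint ?W = ?W" by (simp add: adjoint_mult adjoint_adjoint adjoint_carrier)
  have assoc: "mat_adjoint ?M * (?M * Y) = ?W * Y" if "Y \<in> carrier_mat (q * n) (q * n)" for Y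
    using cS that by (simp add: mult_mat_assoc_dim adjoint_carrier)
  have "?W * 1\<^sub>m (q * n) = ?W * (?W * bcirc Q)"
    by (rule hermitian_pi_regular_imp_regular[OF cW cQ herm Q(3)])
  hence "mat_adjoint ?M * (?M * 1\<^sub>m (q * n)) = mat_adjoint ?M * (?M * (?W * bcirc Q))"
    by (simp only: assoc one_carrier_mat mult_carrier_mat[OF cW cQ])
  hence "?M * 1\<^sub>m (q * n) = ?M * (?W * bcirc Q)"
    by (rule adjoint_mult_cancel[OF cS one_carrier_mat mult_carrier_mat[OF cW cQ]])
  hence inner: "?M * (?W * bcirc Q) = ?M" using cS by simp
  note X = bcirc_t_prod[OF Q(1) S'(1) n]
  have "is_mp_inverse S (Q \<star> t_adjoint S)"
    unfolding is_mp_inverse_iff[OF S n] X(2) S'(2)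
    using X(1) moore_penrose_mat_exists[OF cS cQ Q(2) inner] by blast
  thus ?thesis ..
qed

text \<open>The least number in the definition of the index is meaningful because \<open>T\<^sup>m = T\<^sup>m\<^sup>+\<^sup>1 Q\<close> for some
  \<open>m\<close>, where the ranks agree. At the index itself, equal ranks force equal column spaces, and
  the columns of \<open>Y\<close> express one power through the next.\<close>

lemma t_index_stable:
  assumes T: "T \<in> tensors p p n" and n: "0 < n"
  obtains Y where "Y \<in> carrier_mat (p * n) (p * n)"
    "bcirc T ^\<^sub>m t_index T = bcirc T ^\<^sub>m Suc (t_index T) * Y"
proof -
  let ?M = "bcirc T" and ?N = "p * n"
  note cT = bcirc_carrier[OF T n]
  have cP: "?M ^\<^sub>m j \<in> carrier_mat ?N ?N" for j using cT by simp
  have row: "dim_row ?M = ?N" using cT by simp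
  have sub: "vec_space.col_space ?N (?M ^\<^sub>m Suc j) \<subseteq> vec_space.col_space ?N (?M ^\<^sub>m j)" for j
    unfolding col_space_subset_iff[OF cP cP] using cT by (intro bexI[of _ ?M]) simp_all
  obtain m Q where Q: "Q \<in> tensors p p n" "?M ^\<^sub>m m = ?M ^\<^sub>m Suc m * bcirc Q"
    by (rule tensor_strongly_pi_regular[OF T n])
  have "vec_space.col_space ?N (?M ^\<^sub>m m) \<subseteq> vec_space.col_space ?N (?M ^\<^sub>m Suc m)"
    unfolding col_space_subset_iff[OF cP cP] using Q(2) bcirc_carrier[OF Q(1) n] by blast
  with sub[of m] have "vec_space.rank ?N (?M ^\<^sub>m m) = vec_space.rank ?N (?M ^\<^sub>m Suc m)"
    by (auto simp: vec_space.rank_def vec_space.col_space_def)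
  hence "\<exists>k. vec_space.rank (dim_row ?M) (?M ^\<^sub>m k) = vec_space.rank (dim_row ?M) (?M ^\<^sub>m (k + 1))"
    unfolding row by auto
  from LeastI_ex[OF this, folded t_index_def]
  have "vec_space.rank ?N (?M ^\<^sub>m Suc (t_index T)) = vec_space.rank ?N (?M ^\<^sub>m t_index T)"
    unfolding row by simp
  from rank_eq_imp_col_space_eq[OF cP cP sub this]
  have "vec_space.col_space ?N (?M ^\<^sub>m t_index T) \<subseteq> vec_space.col_space ?N (?M ^\<^sub>m Suc (t_index T))"
    by simp
  thus thesis unfolding col_space_subset_iff[OF cP cP] using that by blast
qed

lemma drazin_inverse_exists:
  assumes T: "T \<in> tensors p p n" and n: "0 < n"
  shows "\<exists>X. is_drazin_inverse T X"
proof -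
  let ?M = "bcirc T" and ?N = "p * n" and ?k = "t_index T"
  note cT = bcirc_carrier[OF T n]
  obtain Y where Y: "Y \<in> carrier_mat ?N ?N" "?M ^\<^sub>m ?k = ?M ^\<^sub>m Suc ?k * Y"
    by (rule t_index_stable[OF T n])
  obtain m Q where Q: "Q \<in> tensors p p n" "?M * bcirc Q = bcirc Q * ?M"
    "?M ^\<^sub>m m = ?M ^\<^sub>m Suc m * bcirc Q"
    by (rule tensor_strongly_pi_regular[OF T n])
  note cQ = bcirc_carrier[OF Q(1) n]
  note X = bcirc_t_prod[OF bcirc_t_pow(1)[OF T n] bcirc_t_pow(1)[OF Q(1) n] n]
  have "is_drazin_inverse T (t_pow T ?k \<star> t_pow Q (Suc ?k))"
    unfolding is_drazin_inverse_iff[OF T n] X(2) bcirc_t_pow(2)[OF T n] bcirc_t_pow(2)[OF Q(1) n]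
    using X(1) drazin_mat_exists[OF cT cQ Q(2) pi_regular_at_index[OF cT cQ Y(1) Q(2,3) Y(2)]]
    by blast
  thus ?thesis ..
qed

lemma mp_inverse_is_outer_inverse:
  assumes S: "S \<in> tensors p q n" and n: "0 < n" and X: "is_mp_inverse S X"
  shows "is_outer_inverse S (t_range (t_adjoint S)) (t_null (t_adjoint S)) X"
proof -
  note S' = bcirc_t_adjoint[OF S n]
  note X = X[unfolded is_mp_inverse_iff[OF S n]]
  have cX: "bcirc X \<in> carrier_mat (q * n) (p * n)" using X bcirc_carrier[OF _ n] by blast
  show ?thesis
    using X moore_penrose_range_null[OF bcirc_carrier[OF S n] cX] bcirc_carrier[OF S'(1) n]
    by (simp add: is_outer_inverse_iff[OF S n] t_range_def t_null_def S'(2))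
qed

lemma drazin_inverse_is_outer_inverse:
  assumes T: "T \<in> tensors p p n" and n: "0 < n" and X: "is_drazin_inverse T X"
  shows "is_outer_inverse T (t_range (t_pow T (t_index T))) (t_null (t_pow T (t_index T))) X"
proof -
  note pow = bcirc_t_pow[OF T n]
  note X = X[unfolded is_drazin_inverse_iff[OF T n]]
  have cX: "bcirc X \<in> carrier_mat (p * n) (p * n)" using X bcirc_carrier[OF _ n] by blast
  have "dim_row (bcirc T ^\<^sub>m t_index T) = p * n" using bcirc_carrier[OF T n] by simp
  thus ?thesis
    using X drazin_range_null[OF bcirc_carrier[OF T n] cX, of "t_index T"]
    by (simp add: is_outer_inverse_iff[OF T n] t_range_def t_null_def pow(2) del: pow_mat.simps)
qed

text \<open>The common logical pattern of both parts: \<open>P\<close> stands for being the Moore-Penrose or Drazin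
  inverse, \<open>Q\<close> for being the outer inverse with prescribed range and null space. Existence
  passes from \<open>P\<close> to \<open>Q\<close>, uniqueness from \<open>Q\<close> to \<open>P\<close>.\<close>

lemma unique_solution_transfer:
  assumes "\<exists>x. P x" "\<And>x. P x \<Longrightarrow> Q x" "\<And>x y. Q x \<Longrightarrow> Q y \<Longrightarrow> x = y"
  shows "(\<exists>!x. P x) \<and> (\<exists>!x. Q x) \<and> (THE x. P x) = (THE x. Q x)"
proof -
  obtain x where x: "P x" using assms(1) ..
  have "P y \<longleftrightarrow> y = x" "Q y \<longleftrightarrow> y = x" for y using x assms(2,3) by blast+
  thus ?thesis by simp
qed

theorem theorem3p13:
  fixes S T :: tensor and p q n k :: nat
  assumes "0 < n"
    and "S \<in> tensors p q n"
    and "T \<in> tensors p p n"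
    and "t_index T = k"
  shows "((\<exists>!X. is_mp_inverse S X) \<and>
          (\<exists>!X. is_outer_inverse S (t_range (t_adjoint S)) (t_null (t_adjoint S)) X) \<and>
          mp_inverse S = outer_inverse S (t_range (t_adjoint S)) (t_null (t_adjoint S))) \<and>
         ((\<exists>!X. is_drazin_inverse T X) \<and>
          (\<exists>!X. is_outer_inverse T (t_range (t_pow T k)) (t_null (t_pow T k)) X) \<and>
          drazin_inverse T = outer_inverse T (t_range (t_pow T k)) (t_null (t_pow T k)))"
proof -
  note n = assms(1) and S = assms(2) and T = assms(3)
  show ?thesis
    unfolding mp_inverse_def drazin_inverse_def outer_inverse_def assms(4)[symmetric]
    by (intro conjI[OF unique_solution_transfer unique_solution_transfer]
        mp_inverse_exists[OF S n] drazin_inverse_exists[OF T n]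
        mp_inverse_is_outer_inverse[OF S n] drazin_inverse_is_outer_inverse[OF T n])
      (blast intro: outer_inverse_unique[OF S n] outer_inverse_unique[OF T n])+
qed

end
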